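(* Let $q$ be a fixed prime power. The number of antichains in $\mathcal{V}(q,n)$ is \[2^{\left(1+O\left(\sqrt{n}\,q^{-n/4}\right)\right)\begin{bmatrix} n\\ \lfloor n/2\rfloor\end{bmatrix}_{q}}\] as $n\to\infty$.
   Context: For a prime power $q$ and integer $n\geq1$, $\mathcal{V}(q,n)$ denotes the poset of all linear subspaces of $\mathbb{F}_q^n$ ordered by inclusion. $\begin{bmatrix} n\\ i\end{bmatrix}_q$ denotes the number of $i$-dimensional subspaces of $\mathbb{F}_q^n$. An antichain is a set of pairwise incomparable elements. *)

theory Defs
  imports "HOL-Analysis.Analysis" "HOL-Library.Function_Algebras" "HOL-Library.Landau_Symbols"
begin

text \<open>Vectors of F_q^n are represented as functions nat => 'a vanishing outside {..<n};
  the finite field F_q is a type 'a of class field and finite, with q = CARD('a).\<close>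

definition fscale :: "'a::field \<Rightarrow> (nat \<Rightarrow> 'a) \<Rightarrow> (nat \<Rightarrow> 'a)" where
  "fscale c v = (\<lambda>i. c * v i)"

definition Fqn :: "nat \<Rightarrow> (nat \<Rightarrow> 'a::field) set" where
  "Fqn n = {v. \<forall>i\<ge>n. v i = 0}"

definition subspaces :: "nat \<Rightarrow> (nat \<Rightarrow> 'a::field) set set" where
  "subspaces n = {W. W \<subseteq> Fqn n \<and> module.subspace fscale W}"

definition gauss_binom :: "'a::field itself \<Rightarrow> nat \<Rightarrow> nat \<Rightarrow> nat" where
  "gauss_binom _ n i = card {W \<in> (subspaces n :: (nat \<Rightarrow> 'a) set set). vector_space.dim fscale W = i}"

definition is_antichain :: "nat \<Rightarrow> (nat \<Rightarrow> 'a::field) set set \<Rightarrow> bool" where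
  "is_antichain n A \<longleftrightarrow> A \<subseteq> subspaces n \<and> (\<forall>X\<in>A. \<forall>Y\<in>A. X \<subseteq> Y \<longrightarrow> X = Y)"

definition num_antichains :: "'a::field itself \<Rightarrow> nat \<Rightarrow> nat" where
  "num_antichains _ n = card {A :: (nat \<Rightarrow> 'a) set set. is_antichain n A}"

end

(* Idea.  The lower bound counts the subsets of the middle layer.  For the upper bound, antichains
   are independent sets of the comparability graph, and branching on a vertex v of degree >= s,
   i(U) <= i(U - v) + i(U - v - N(v)), gives i(S) <= 2^K exp(|S| ln s / s) as soon as every vertex
   set with more than K elements contains a vertex of degree >= s.

   Such a K comes from a supersaturated LYM inequality: a random complete flag contains a fixed
   X with probability 1/[n, dim X] >= 1/N, where N is the middle Gaussian binomial coefficient, and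
   contains a proper nontrivial pair X < Y with probability at most q^(1 - n div 2) times the larger
   of the probabilities of X and Y.  If all degrees in U are at most s, then comparing the number of
   elements of U on the flag with one plus the number of its comparable pairs yields
   |U| (1 - s q^(1 - n div 2)) <= N.

   Since the whole poset has at most 4 N elements, s = sqrt n q^(n/4) balances the two error terms
   s q^(-n/2) and ln s / s. *)

theory Submission
  imports Defs "HOL-Real_Asymp.Real_Asymp"
begin

section \<open>Independent sets in locally dense graphs\<close>

text \<open>An independent set either avoids the branching vertex v or contains it and avoids all
  its neighbours. With \<delta> = ln s / s the bound survives this step because exp(-\<delta>) +
  exp(-\<delta> (1 + s)) \<le> 1; a set with at most \<open>K\<close> vertices contributes all its
  subsets. Adjacency means \<open>R\<close> in either direction, so that inclusion can be taken for
  \<open>R\<close>.\<close>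

lemma card_independent_sets_le:
  fixes R :: "'v \<Rightarrow> 'v \<Rightarrow> bool" and s K :: real
  assumes "finite S" and s: "s \<ge> exp 1"
    and dense: "\<And>U. \<lbrakk>U \<subseteq> S; real (card U) > K\<rbrakk> \<Longrightarrow> \<exists>v\<in>U. s \<le> card {u\<in>U. u \<noteq> v \<and> (R u v \<or> R v u)}"
  shows "real (card {A. A \<subseteq> S \<and> (\<forall>x\<in>A. \<forall>y\<in>A. R x y \<longrightarrow> x = y)})
           \<le> 2 powr K * exp (ln s / s * card S)"
  using assms(1) dense
proof (induction S rule: finite_psubset_induct)
  case (psubset S)
  let ?I = "\<lambda>S. {A. A \<subseteq> S \<and> (\<forall>x\<in>A. \<forall>y\<in>A. R x y \<longrightarrow> x = y)}"
  let ?\<delta> = "ln s / s"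
  have s1: "s \<ge> 1" using s exp_ge_add_one_self[of 1] by linarith
  have ln1: "ln s \<ge> 1" using s s1 by (subst ln_ge_iff) auto
  have fin: "finite (?I T)" if "T \<subseteq> S" for T
    by (rule finite_subset[of _ "Pow T"]) (use psubset.hyps that finite_subset in auto)
  show ?case
  proof (cases "real (card S) > K")
    case False
    have "card (?I S) \<le> card (Pow S)"
      by (rule card_mono) (use psubset.hyps in auto)
    also have "\<dots> = 2 ^ card S" using psubset.hyps by (simp add: card_Pow)
    finally have "real (card (?I S)) \<le> real (2 ^ card S)" by (rule of_nat_mono)
    also have "\<dots> = 2 powr (card S)" by (simp add: powr_realpow)
    also have "\<dots> \<le> 2 powr K" using False by simp
    also have "\<dots> \<le> 2 powr K * exp (?\<delta> * card S)"
      using s1 by simp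
    finally show ?thesis .
  next
    case True
    then obtain v where v: "v \<in> S" and deg: "s \<le> card {u\<in>S. u \<noteq> v \<and> (R u v \<or> R v u)}"
      using psubset.prems by blast
    define Nv where "Nv = {u\<in>S. u \<noteq> v \<and> (R u v \<or> R v u)}"
    define S1 where "S1 = S - {v}"
    define S2 where "S2 = S1 - Nv"
    have sub: "S1 \<subset> S" "S2 \<subset> S" using v by (auto simp: S1_def S2_def)
    have c1: "real (card S1) = real (card S) - 1"
      using card_Suc_Diff1[OF psubset.hyps v] unfolding S1_def by linarith
    have NvS1: "Nv \<subseteq> S1" by (auto simp: Nv_def S1_def)
    have fS1: "finite S1" using psubset.hyps by (simp add: S1_def)
    have "card S2 + card Nv = card S1"
      using card_Diff_subset[OF finite_subset[OF NvS1 fS1] NvS1] card_mono[OF fS1 NvS1]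
      unfolding S2_def by simp
    then have c2: "real (card S2) \<le> real (card S) - 1 - s" using c1 deg unfolding Nv_def by linarith
    have "?I S \<subseteq> ?I S1 \<union> insert v ` ?I S2"
    proof
      fix A assume A: "A \<in> ?I S"
      show "A \<in> ?I S1 \<union> insert v ` ?I S2"
      proof (cases "v \<in> A")
        case True
        have AS: "A \<subseteq> S" and Aind: "\<And>x y. \<lbrakk>x \<in> A; y \<in> A; R x y\<rbrakk> \<Longrightarrow> x = y"
          using A by simp_all
        have "A - {v} \<subseteq> S2"
        proof
          fix u assume "u \<in> A - {v}"
          then show "u \<in> S2"
            using AS Aind[of u v] Aind[of v u] True unfolding S2_def S1_def Nv_def by blast
        qed
        then have "A - {v} \<in> ?I S2" by (simp add: Aind)
        then have "insert v (A - {v}) \<in> ?I S1 \<union> insert v ` ?I S2" by (intro UnI2 imageI)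
        then show ?thesis by (simp only: insert_Diff[OF True])
      next
        case False
        then have "A \<subseteq> S1" using A unfolding S1_def by blast
        then show ?thesis using A by simp
      qed
    qed
    then have "card (?I S) \<le> card (?I S1 \<union> insert v ` ?I S2)"
      using fin[of S1] fin[of S2] sub by (intro card_mono) auto
    also have "\<dots> \<le> card (?I S1) + card (insert v ` ?I S2)" by (rule card_Un_le)
    also have "\<dots> \<le> card (?I S1) + card (?I S2)"
      using card_image_le[OF fin[of S2], of "insert v"] sub by auto
    finally have "real (card (?I S)) \<le> real (card (?I S1) + card (?I S2))" by (rule of_nat_mono)
    also have "\<dots> = real (card (?I S1)) + real (card (?I S2))" by simp
    also have "\<dots> \<le> 2 powr K * exp (?\<delta> * card S1) + 2 powr K * exp (?\<delta> * card S2)"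
      using sub by (intro add_mono psubset.IH psubset.prems) auto
    also have "\<dots> \<le> 2 powr K * exp (?\<delta> * (real (card S) - 1)) + 2 powr K * exp (?\<delta> * (real (card S) - 1 - s))"
      using c1 c2 s1 by (intro add_mono mult_left_mono) (auto intro!: mult_left_mono divide_right_mono)
    \<comment> \<open>The choice of \<open>?\<delta>\<close> turns the loss of s neighbours into the
      factor exp(-ln s) = 1 / s.\<close>
    also have "\<dots> = 2 powr K * exp (?\<delta> * (real (card S) - 1)) * (1 + 1 / s)"
    proof -
      have "exp (?\<delta> * (real (card S) - 1 - s)) = exp (?\<delta> * (real (card S) - 1)) * exp (- (ln s))"
        using s1 by (simp flip: exp_add) (simp add: field_simps)
      also have "exp (- (ln s)) = 1 / s" using s1 by (simp add: exp_minus field_simps)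
      finally show ?thesis by (simp add: algebra_simps)
    qed
    \<comment> \<open>From s \<ge> e comes ln s \<ge> 1, so 1 + 1 / s \<le> 1 +
      \<open>?\<delta>\<close> \<le> exp \<open>?\<delta>\<close>; this restores v in the
      exponent.\<close>
    also have "\<dots> \<le> 2 powr K * exp (?\<delta> * (real (card S) - 1)) * exp ?\<delta>"
    proof (intro mult_left_mono)
      have "1 / s \<le> ?\<delta>" using ln1 s1 by (simp add: divide_right_mono)
      then show "1 + 1 / s \<le> exp ?\<delta>" using exp_ge_add_one_self[of ?\<delta>] by linarith
    qed auto
    also have "\<dots> = 2 powr K * exp (?\<delta> * card S)"
      by (simp add: mult.assoc flip: exp_add) (simp add: algebra_simps diff_divide_distrib add_divide_distrib)
    finally show ?thesis .
  qed
qed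

text \<open>Pairing the least element of the chain with each of the others already gives |C| - 1
  comparable pairs.\<close>

lemma card_chain_le:
  assumes "finite C" and chain: "\<And>X Y. X \<in> C \<Longrightarrow> Y \<in> C \<Longrightarrow> X \<subseteq> Y \<or> Y \<subseteq> X"
  shows "card C \<le> 1 + card {(X, Y). X \<in> C \<and> Y \<in> C \<and> X \<subset> Y}"
proof (cases "C = {}")
  case False
  obtain M where M: "M \<in> C" "\<And>X. X \<in> C \<Longrightarrow> X \<subseteq> M \<Longrightarrow> X = M"
    using finite_has_minimal[OF assms(1) False] by blast
  then have "Pair M ` (C - {M}) \<subseteq> {(X, Y). X \<in> C \<and> Y \<in> C \<and> X \<subset> Y}"
    using chain by blast
  moreover have "finite {(X, Y). X \<in> C \<and> Y \<in> C \<and> X \<subset> Y}"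
    by (rule finite_subset[of _ "C \<times> C"]) (use assms in auto)
  ultimately have "card (Pair M ` (C - {M})) \<le> card {(X, Y). X \<in> C \<and> Y \<in> C \<and> X \<subset> Y}"
    by (rule card_mono[rotated])
  moreover have "card (Pair M ` (C - {M})) = card C - 1"
    using M by (subst card_image) (auto simp: inj_on_def)
  ultimately show ?thesis by linarith
qed auto

section \<open>Subspaces and frames over a finite field\<close>

text \<open>The space of all functions nat => F_q is infinite-dimensional, so finiteness is imposed
  on single subspaces, and facts about dimension are read off from |W| = q^dim W.\<close>

locale finite_field_space = vector_space scale
  for scale :: "'a::{field, finite} \<Rightarrow> 'b::ab_group_add \<Rightarrow> 'b" +
  fixes q :: nat
  assumes q_eq: "q = CARD('a)"
begin

lemma q_ge_2: "q \<ge> 2"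
proof -
  have "card {0, 1::'a} \<le> q" unfolding q_eq by (rule card_mono) auto
  then show ?thesis by simp
qed

text \<open>Adjoining b multiplies the span by q: (c, x) -> c b + x is injective on F x span B,
  since a collision with distinct coefficients would put b into span B.\<close>

lemma card_span_independent:
  assumes "finite B" "independent B"
  shows "finite (span B) \<and> card (span B) = q ^ card B"
  using assms
proof (induction B rule: finite_induct)
  case (insert b B)
  then have IH: "finite (span B)" "card (span B) = q ^ card B" and b: "b \<notin> span B"
    by (auto simp: independent_insert)
  let ?f = "\<lambda>(c, x). scale c b + x"
  have eq: "span (insert b B) = ?f ` (UNIV \<times> span B)"
  proof (intro equalityI subsetI)
    fix x assume "x \<in> span (insert b B)"
    then obtain k where "x - scale k b \<in> span B" by (auto simp: span_insert)
    then show "x \<in> ?f ` (UNIV \<times> span B)"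
      by (intro image_eqI[of _ _ "(k, x - scale k b)"]) auto
  qed (auto intro: span_add span_scale span_base span_mono[THEN subsetD, of B])
  have "inj_on ?f (UNIV \<times> span B)"
  proof (rule inj_onI, clarsimp)
    fix c x d y assume *: "x \<in> span B" "y \<in> span B" "scale c b + x = scale d b + y"
    then have e: "scale (c - d) b = y - x" by (simp add: scale_left_diff_distrib algebra_simps)
    have "c = d"
    proof (rule ccontr)
      assume "c \<noteq> d"
      have "scale (c - d) b \<in> span B" using e * span_diff by simp
      then have "scale (inverse (c - d)) (scale (c - d) b) \<in> span B" by (rule span_scale)
      then show False using \<open>c \<noteq> d\<close> b by simp
    qed
    then show "c = d \<and> x = y" using * by simp
  qed
  then show ?case using IH insert.hyps by (simp add: eq card_image card_cartesian_product q_eq)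
qed simp

lemma card_subspace:
  assumes "subspace W" "finite W"
  shows "card W = q ^ dim W"
proof -
  obtain B where B: "B \<subseteq> W" "independent B" "W \<subseteq> span B" "card B = dim W"
    using basis_exists by blast
  then have "span B = W" using assms(1) by (simp add: span_subspace)
  then show ?thesis using card_span_independent[of B] B assms(2) finite_subset by auto
qed

lemma dim_mono_finite:
  assumes "subspace U" "subspace W" "finite W" "U \<subseteq> W"
  shows "dim U \<le> dim W"
proof -
  have "q ^ dim U \<le> q ^ dim W"
    using card_subspace[OF assms(1) finite_subset[OF assms(4,3)]] card_subspace[OF assms(2,3)]
      card_mono[OF assms(3,4)] by simp
  then show ?thesis using q_ge_2 by simp
qed

lemma subspace_dim_equal_finite:
  assumes "subspace U" "subspace W" "finite W" "U \<subseteq> W" "dim U = dim W"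
  shows "U = W"
proof (rule card_seteq[OF assms(3,4)])
  show "card W \<le> card U"
    using card_subspace[OF assms(1) finite_subset[OF assms(4,3)]] card_subspace[OF assms(2,3)] assms(5)
    by simp
qed

lemma dim_span_insert:
  assumes "subspace U" "finite U" "x \<notin> U"
  shows "dim (span (insert x U)) = Suc (dim U)"
proof -
  obtain B where B: "B \<subseteq> U" "independent B" "U \<subseteq> span B" "card B = dim U"
    using basis_exists by blast
  then have s: "span B = U" using assms(1) by (simp add: span_subspace)
  have "span (insert x U) = span (insert x B)"
    unfolding span_insert using s by (simp add: span_span flip: s)
  moreover have "independent (insert x B)" using B s assms by (simp add: independent_insertI)
  moreover have "card (insert x B) = Suc (card B)"
    using B assms s span_base finite_subset by (metis card_insert_disjoint)
  ultimately show ?thesis using B dim_span_eq_card_independent by metis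
qed

text \<open>The entries of the list are linearly independent modulo \<open>U\<close>.\<close>

fun extends :: "'b set \<Rightarrow> 'b list \<Rightarrow> bool" where
  "extends U [] \<longleftrightarrow> True"
| "extends U (x # xs) \<longleftrightarrow> x \<notin> U \<and> extends (span (insert x U)) xs"

text \<open>Ordered lists rather than sets of vectors, so that they are counted one entry at a time
  and cut at any position. For \<open>U = {0}\<close> and m = dim W they are the ordered bases of
  W.\<close>

definition frames :: "'b set \<Rightarrow> 'b set \<Rightarrow> nat \<Rightarrow> 'b list set" where
  "frames W U m = {xs. length xs = m \<and> set xs \<subseteq> W \<and> extends U xs}"

text \<open>With i vectors chosen, the next one lies in a w-dimensional space and avoids a subspace
  of dimension u + i. Real values keep the differences free of truncation.\<close>

definition frame_count :: "nat \<Rightarrow> nat \<Rightarrow> nat \<Rightarrow> real" where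
  "frame_count w u m = (\<Prod>i<m. real q ^ w - real q ^ (u + i))"

lemma finite_frames: "finite W \<Longrightarrow> finite (frames W U m)"
  using finite_lists_length_eq[of W m] by (rule rev_finite_subset) (auto simp: frames_def)

text \<open>Induction on the length: the first entry x is any vector of W - U, and the rest is a
  frame over the span of U and x, whose dimension is one larger. If m exceeds dim W - dim U, a
  factor vanishes, as it should.\<close>

lemma card_frames:
  assumes "subspace W" "finite W" "subspace U" "U \<subseteq> W"
  shows "real (card (frames W U m)) = frame_count (dim W) (dim U) m"
  using assms(3,4)
proof (induction m arbitrary: U)
  case 0
  have "frames W U 0 = {[]}" by (auto simp: frames_def)
  then show ?case by (simp add: frame_count_def)
next
  case (Suc m)
  note finU = finite_subset[OF Suc.prems(2) assms(2)]
  let ?S = "SIGMA x:W - U. frames W (span (insert x U)) m"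
  have eq: "frames W U (Suc m) = (\<lambda>(x, xs). x # xs) ` ?S"
    by (auto simp: frames_def length_Suc_conv image_iff)
  have inj: "inj_on (\<lambda>(x, xs). x # xs) ?S" by (auto simp: inj_on_def)
  have IH: "real (card (frames W (span (insert x U)) m)) = frame_count (dim W) (Suc (dim U)) m"
    if "x \<in> W - U" for x
    using Suc.IH[of "span (insert x U)"] dim_span_insert[OF Suc.prems(1) finU, of x] that
      assms(1) Suc.prems span_minimal[of "insert x U" W] by auto
  have "real (card (frames W U (Suc m))) = (\<Sum>x\<in>W - U. real (card (frames W (span (insert x U)) m)))"
    unfolding eq using assms(2) by (subst card_image[OF inj]) (simp add: finite_frames)
  also have "\<dots> = real (card (W - U)) * frame_count (dim W) (Suc (dim U)) m"
    using IH by simp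
  also have "real (card (W - U)) = real q ^ dim W - real q ^ dim U"
    using card_Diff_subset[OF finU Suc.prems(2)] card_mono[OF assms(2) Suc.prems(2)]
      card_subspace[OF assms(1,2)] card_subspace[OF Suc.prems(1) finU]
    by (simp add: of_nat_diff)
  finally show ?case
    unfolding frame_count_def by (subst prod.lessThan_Suc_shift) simp
qed

lemma span_span_Un: "span (span A \<union> B) = span (A \<union> B)"
  by (simp add: span_Un span_span)

lemma extends_append: "extends U (xs @ ys) \<longleftrightarrow> extends U xs \<and> extends (span (U \<union> set xs)) ys" if "subspace U"
  using that
proof (induction xs arbitrary: U)
  case Nil
  then have "span (U \<union> set []) = U" by (metis Un_empty_right list.set(1) span_eq_iff)
  then show ?case by (simp only: append_Nil extends.simps simp_thms)
next
  case (Cons x xs)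
  have "span (span (insert x U) \<union> set xs) = span (U \<union> set (x # xs))"
    by (simp add: span_span_Un)
  then show ?case using Cons.IH[of "span (insert x U)"] by simp
qed

lemma dim_span_frame:
  assumes "subspace W" "finite W" "subspace U" "U \<subseteq> W" "xs \<in> frames W U m"
  shows "dim (span (U \<union> set xs)) = dim U + m"
  using assms(3-)
proof (induction m arbitrary: U xs)
  case 0
  then show ?case by (auto simp: frames_def)
next
  case (Suc m)
  then obtain x ys where xs: "xs = x # ys" "x \<in> W - U" "ys \<in> frames W (span (insert x U)) m"
    by (auto simp: frames_def length_Suc_conv)
  have "dim (span (span (insert x U) \<union> set ys)) = dim (span (insert x U)) + m"
    using xs Suc.prems assms(1) span_minimal[of "insert x U" W] by (intro Suc.IH) auto
  moreover have "span (span (insert x U) \<union> set ys) = span (U \<union> set xs)"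
    unfolding xs by (simp add: span_span_Un)
  ultimately show ?case
    using dim_span_insert[OF Suc.prems(1)] finite_subset[OF Suc.prems(2) assms(2)] xs by simp
qed

text \<open>A frame over U inside X of length dim X - dim U spans X by dimension. Hence the frame
  sets on the left are the fibres of the map that sends a frame to its span with U.\<close>

lemma frames_spanning:
  assumes "subspace W" "finite W" "subspace U" "U \<subseteq> X" "subspace X" "X \<subseteq> W" "dim X = dim U + m"
  shows "frames X U m = {xs \<in> frames W U m. span (U \<union> set xs) = X}"
proof (intro equalityI subsetI)
  fix xs assume xs: "xs \<in> frames X U m"
  have "finite X" using assms finite_subset by auto
  then have "dim (span (U \<union> set xs)) = dim X"
    using dim_span_frame[OF assms(5) _ assms(3,4) xs] assms by simp
  moreover have "span (U \<union> set xs) \<subseteq> X"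
    using xs assms by (intro span_minimal) (auto simp: frames_def)
  ultimately have "span (U \<union> set xs) = X"
    using subspace_dim_equal_finite[OF _ assms(5) \<open>finite X\<close>] by auto
  then show "xs \<in> {xs \<in> frames W U m. span (U \<union> set xs) = X}"
    using xs assms by (auto simp: frames_def)
qed (auto simp: frames_def span_base)

text \<open>Concatenation is a bijection from pairs of a frame of X over U and a member of
  \<open>Q\<close>. The condition \<open>Q\<close> on the second piece allows cutting twice, for
  flags through two subspaces.\<close>

lemma card_frames_through:
  assumes "subspace W" "finite W" "subspace U" "U \<subseteq> X" "subspace X" "X \<subseteq> W" "dim X = dim U + k"
    and Q: "Q \<subseteq> frames W X m"
  shows "card {zs \<in> frames W U (k + m). span (U \<union> set (take k zs)) = X \<and> drop k zs \<in> Q}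
           = card (frames X U k) * card Q"
proof -
  let ?f = "\<lambda>(xs, ys). xs @ ys"
  let ?T = "{zs \<in> frames W U (k + m). span (U \<union> set (take k zs)) = X \<and> drop k zs \<in> Q}"
  note sp = frames_spanning[OF assms(1-7)]
  have len: "length xs = k" if "xs \<in> frames X U k" for xs
    using that by (simp add: frames_def)
  have "inj_on ?f (frames X U k \<times> Q)"
  proof (rule inj_onI, clarify)
    fix xs ys xs' ys'
    assume "xs \<in> frames X U k" "xs' \<in> frames X U k" "xs @ ys = xs' @ ys'"
    then show "xs = xs' \<and> ys = ys'" using len[of xs] len[of xs'] by simp
  qed
  moreover have "?f ` (frames X U k \<times> Q) = ?T"
  proof (intro equalityI subsetI)
    fix zs assume "zs \<in> ?f ` (frames X U k \<times> Q)"
    then obtain xs ys where z: "zs = xs @ ys" "xs \<in> frames X U k" "ys \<in> Q" by auto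
    have xs: "xs \<in> frames W U k" "span (U \<union> set xs) = X" using z(2) unfolding sp by auto
    have ys: "ys \<in> frames W X m" using Q z(3) by blast
    have "zs \<in> frames W U (k + m)"
      using xs ys extends_append[OF assms(3), of xs ys] unfolding z(1) frames_def by simp
    then show "zs \<in> ?T" using z len[OF z(2)] xs by simp
  next
    fix zs assume zs: "zs \<in> ?T"
    then have ap: "extends U (take k zs) \<and> extends X (drop k zs)"
      using extends_append[OF assms(3), of "take k zs" "drop k zs"] by (simp add: frames_def)
    have "take k zs \<in> frames X U k"
      unfolding sp using zs ap set_take_subset[of k zs] by (auto simp: frames_def)
    then show "zs \<in> ?f ` (frames X U k \<times> Q)"
      using zs by (intro image_eqI[of _ _ "(take k zs, drop k zs)"]) auto
  qed
  ultimately have "bij_betw ?f (frames X U k \<times> Q) ?T" by (simp add: bij_betw_def)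
  then have "card (frames X U k \<times> Q) = card ?T" by (rule bij_betw_same_card)
  then show ?thesis by (simp only: card_cartesian_product)
qed

section \<open>Estimates for the number of frames\<close>

lemma frame_count_pos:
  assumes "u + m \<le> w" shows "frame_count w u m > 0"
  unfolding frame_count_def
  by (rule prod_pos) (use assms q_ge_2 in \<open>auto intro!: power_strict_increasing\<close>)

lemma frame_count_add: "frame_count w u (a + b) = frame_count w u a * frame_count w (u + a) b"
  by (induction b) (simp_all add: frame_count_def algebra_simps)

text \<open>Factor by factor, (q^w - q^(u+i)) q^(w'-w) \<le> q^w' - q^(u+i). This is the source of
  the power of q gained in \<open>card_flags_2_le\<close>.\<close>

lemma frame_count_mono:
  assumes "w \<le> w'" "u + m \<le> w"
  shows "frame_count w u m * real q ^ ((w' - w) * m) \<le> frame_count w' u m"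
proof -
  have "frame_count w u m * real q ^ ((w' - w) * m) = (\<Prod>i<m. (real q ^ w - real q ^ (u + i)) * real q ^ (w' - w))"
    unfolding frame_count_def by (simp add: prod.distrib power_mult)
  also have "\<dots> \<le> frame_count w' u m"
    unfolding frame_count_def
  proof (intro prod_mono conjI)
    fix i assume i: "i \<in> {..<m}"
    then show "0 \<le> (real q ^ w - real q ^ (u + i)) * real q ^ (w' - w)"
      using assms q_ge_2 by (auto intro!: mult_nonneg_nonneg power_increasing)
    have "real q ^ (u + i) * 1 \<le> real q ^ (u + i) * real q ^ (w' - w)"
      using q_ge_2 by (intro mult_left_mono one_le_power) auto
    then show "(real q ^ w - real q ^ (u + i)) * real q ^ (w' - w) \<le> real q ^ w' - real q ^ (u + i)"
      using assms by (simp add: left_diff_distrib flip: power_add)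
  qed
  finally show ?thesis .
qed

end

section \<open>Flags through given subspaces\<close>

context finite_field_space
begin

lemma dim_zero: "dim {0} = 0"
  using card_subspace[OF subspace_single_0] q_ge_2 by (cases "dim {0}") auto

definition subspaces_of :: "'b set \<Rightarrow> 'b set set" where
  "subspaces_of V = {W. W \<subseteq> V \<and> subspace W}"

definition gbinom :: "'b set \<Rightarrow> nat \<Rightarrow> nat" where
  "gbinom V k = card {W \<in> subspaces_of V. dim W = k}"

text \<open>A complete flag is represented by an ordered basis whose initial segments span its
  members. Every flag arises from equally many bases, so counting bases gives the probabilities for
  random flags.\<close>

definition flag :: "'b list \<Rightarrow> nat \<Rightarrow> 'b set" where
  "flag zs k = span (set (take k zs))"

lemma finite_subspaces_of: "finite V \<Longrightarrow> finite (subspaces_of V)"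
  by (rule finite_subset[of _ "Pow V"]) (auto simp: subspaces_of_def)

lemma flag_mono: "i \<le> j \<Longrightarrow> flag zs i \<subseteq> flag zs j"
  unfolding flag_def by (intro span_mono set_take_subset_set_take)

context
  fixes V :: "'b set" and n :: nat
  assumes V: "subspace V" "finite V" and n: "n = dim V"
begin

lemma subspaces_ofD:
  assumes "X \<in> subspaces_of V"
  shows "subspace X" "X \<subseteq> V" "finite X" "{0} \<subseteq> X" "dim X \<le> n"
  using assms V n dim_mono_finite[of X V] finite_subset[of X V]
  by (auto simp: subspaces_of_def subspace_0)

lemma card_frames_below:
  assumes "X \<in> subspaces_of V"
  shows "real (card (frames X {0} m)) = frame_count (dim X) 0 m"
  using card_frames[OF subspaces_ofD(1,3)[OF assms] subspace_single_0 subspaces_ofD(4)[OF assms]]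
  by (simp add: dim_zero)

lemma card_flags_through:
  assumes X: "X \<in> subspaces_of V" and Q: "Q \<subseteq> frames V X (n - dim X)"
  shows "real (card {zs \<in> frames V {0} n. flag zs (dim X) = X \<and> drop (dim X) zs \<in> Q})
    = frame_count (dim X) 0 (dim X) * card Q"
proof -
  note X' = subspaces_ofD[OF X]
  have "card {zs \<in> frames V {0} n. flag zs (dim X) = X \<and> drop (dim X) zs \<in> Q}
      = card (frames X {0} (dim X)) * card Q"
    using card_frames_through[OF V subspace_single_0 X'(4,1,2), of "dim X" Q "n - dim X"] Q X'(5)
    by (simp add: dim_zero flag_def)
  then show ?thesis using card_frames_below[OF X] by simp
qed

lemma drop_frame:
  assumes X: "X \<in> subspaces_of V" and zs: "zs \<in> frames V {0} n" "flag zs (dim X) = X"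
  shows "drop (dim X) zs \<in> frames V X (n - dim X)"
proof -
  have "extends {0} (take (dim X) zs @ drop (dim X) zs)" using zs by (simp add: frames_def)
  then have "extends X (drop (dim X) zs)"
    using zs(2) unfolding extends_append[OF subspace_single_0] flag_def by simp
  then show ?thesis using zs(1) set_drop_subset[of "dim X" zs] by (auto simp: frames_def)
qed

lemma card_flags_1:
  assumes X: "X \<in> subspaces_of V"
  shows "real (card {zs \<in> frames V {0} n. flag zs (dim X) = X})
    = frame_count (dim X) 0 (dim X) * frame_count n (dim X) (n - dim X)"
proof -
  have "{zs \<in> frames V {0} n. flag zs (dim X) = X} = {zs \<in> frames V {0} n. flag zs (dim X) = X
      \<and> drop (dim X) zs \<in> frames V X (n - dim X)}"
    using drop_frame[OF X] by blast
  then show ?thesis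
    using card_flags_through[OF X order.refl] card_frames[OF V subspaces_ofD(1,2)[OF X]] n by simp
qed

text \<open>Cut the basis at dim X, then cut the remaining part after dim Y - dim X further entries;
  the three pieces are chosen independently.\<close>

lemma card_flags_2:
  assumes X: "X \<in> subspaces_of V" and Y: "Y \<in> subspaces_of V" and XY: "X \<subseteq> Y"
  shows "real (card {zs \<in> frames V {0} n. flag zs (dim X) = X \<and> flag zs (dim Y) = Y})
    = frame_count (dim X) 0 (dim X) * (frame_count (dim Y) (dim X) (dim Y - dim X)
        * frame_count n (dim Y) (n - dim Y))"
proof -
  note X' = subspaces_ofD[OF X] and Y' = subspaces_ofD[OF Y]
  define d where "d = dim Y - dim X"
  have le: "dim X \<le> dim Y" using dim_mono_finite X' Y' XY by blast
  \<comment> \<open>The admissible tails: those whose first d entries enlarge X to Y.\<close>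
  let ?Q = "{ys \<in> frames V X (n - dim X). span (X \<union> set (take d ys)) = Y}"
  have flagY: "flag zs (dim Y) = span (X \<union> set (take d (drop (dim X) zs)))"
    if "flag zs (dim X) = X" for zs
  proof -
    have "take (dim Y) zs = take (dim X) zs @ take d (drop (dim X) zs)"
      using le take_add[of "dim X" d zs] by (simp add: d_def)
    then have "flag zs (dim Y) = span (flag zs (dim X) \<union> set (take d (drop (dim X) zs)))"
      by (simp only: flag_def set_append span_span_Un)
    then show ?thesis by (simp only: that)
  qed
  have "{zs \<in> frames V {0} n. flag zs (dim X) = X \<and> flag zs (dim Y) = Y}
     = {zs \<in> frames V {0} n. flag zs (dim X) = X \<and> drop (dim X) zs \<in> ?Q}"
    using drop_frame[OF X] flagY by auto
  then have "real (card {zs \<in> frames V {0} n. flag zs (dim X) = X \<and> flag zs (dim Y) = Y})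
    = frame_count (dim X) 0 (dim X) * card ?Q"
    using card_flags_through[OF X, of ?Q] by simp
  also have "?Q = {ys \<in> frames V X (d + (n - dim Y)). span (X \<union> set (take d ys)) = Y
      \<and> drop d ys \<in> frames V Y (n - dim Y)}"
  proof -
    have e: "n - dim X = d + (n - dim Y)" using le Y' by (simp add: d_def)
    have "drop d ys \<in> frames V Y (n - dim Y)"
      if ys: "ys \<in> frames V X (d + (n - dim Y))" "span (X \<union> set (take d ys)) = Y" for ys
    proof -
      have "extends X (take d ys @ drop d ys)" using ys by (simp add: frames_def)
      then have "extends Y (drop d ys)"
        using ys(2) unfolding extends_append[OF X'(1)] by simp
      then show ?thesis using ys(1) set_drop_subset[of d ys] by (auto simp: frames_def)
    qed
    then show ?thesis unfolding e by blast
  qed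
  also have "card \<dots> = card (frames Y X d) * card (frames V Y (n - dim Y))"
    by (rule card_frames_through[OF V X'(1) XY Y'(1,2) _ order.refl]) (use le in \<open>simp add: d_def\<close>)
  finally show ?thesis
    using card_frames[OF Y'(1,3) X'(1) XY] card_frames[OF V Y'(1,2)] n by (simp add: d_def)
qed

text \<open>Sort the k-frames of V by their span: every k-dimensional subspace has the same number
  of ordered bases.\<close>

lemma gbinom_frame_count:
  assumes "k \<le> n"
  shows "real (gbinom V k) * frame_count k 0 k = frame_count n 0 k"
proof -
  let ?L = "{W \<in> subspaces_of V. dim W = k}"
  have fib: "frames X {0} k = {xs \<in> frames V {0} k. span (set xs) = X}" if "X \<in> ?L" for X
    using frames_spanning[OF V subspace_single_0, of X k] that subspaces_ofD[of X]
    by (simp add: dim_zero)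
  have "frames V {0} k = (\<Union>X\<in>?L. frames X {0} k)"
  proof (intro equalityI subsetI)
    fix xs assume xs: "xs \<in> frames V {0} k"
    have "dim (span (set xs)) = k"
      using dim_span_frame[OF V subspace_single_0 _ xs] V by (simp add: dim_zero subspace_0)
    moreover have "span (set xs) \<subseteq> V"
      using xs V by (intro span_minimal) (auto simp: frames_def)
    ultimately have "span (set xs) \<in> ?L" by (simp add: subspaces_of_def)
    then show "xs \<in> (\<Union>X\<in>?L. frames X {0} k)" using fib xs by blast
  qed (use fib in auto)
  also have "card \<dots> = (\<Sum>X\<in>?L. card (frames X {0} k))"
  proof (rule card_UN_disjoint)
    show "finite ?L" using finite_subspaces_of[OF V(2)] by simp
    show "\<forall>X\<in>?L. finite (frames X {0} k)"
      using finite_frames subspaces_ofD(3) by blast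
    show "\<forall>X\<in>?L. \<forall>Y\<in>?L. X \<noteq> Y \<longrightarrow> frames X {0} k \<inter> frames Y {0} k = {}"
      using fib by blast
  qed
  finally have "real (card (frames V {0} k)) = (\<Sum>X\<in>?L. real (card (frames X {0} k)))" by simp
  also have "\<dots> = (\<Sum>X\<in>?L. frame_count k 0 k)"
    using card_frames_below by (intro sum.cong) auto
  also have "\<dots> = real (gbinom V k) * frame_count k 0 k" by (simp add: gbinom_def)
  finally show ?thesis
    using card_frames[OF V subspace_single_0, of k] V n by (simp add: dim_zero subspace_0)
qed

definition flags_through :: "'b set \<Rightarrow> real" where
  "flags_through X = real (card {zs \<in> frames V {0} n. flag zs (dim X) = X})"

text \<open>In other words, a random flag contains X with probability 1 /
  \<open>gbinom V (dim X)\<close>, as there are \<open>frame_count n 0 n\<close> ordered bases of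
  V.\<close>

lemma flags_through_gbinom:
  assumes X: "X \<in> subspaces_of V"
  shows "real (gbinom V (dim X)) * flags_through X = frame_count n 0 n"
proof -
  note X' = subspaces_ofD[OF X]
  have "real (gbinom V (dim X)) * flags_through X
      = frame_count n 0 (dim X) * frame_count n (dim X) (n - dim X)"
    unfolding flags_through_def card_flags_1[OF X] using gbinom_frame_count[OF X'(5)] by simp
  also have "\<dots> = frame_count n 0 n"
    using frame_count_add[of n 0 "dim X" "n - dim X"] X'(5) by simp
  finally show ?thesis .
qed

text \<open>Put x = dim X and y = dim Y. A flag through Y contains X with probability at most
  q^(-x(y-x)), and a flag through X contains Y with probability at most q^(-(y-x)(n-y)). The first
  estimate serves for y \<ge> n div 2, the second otherwise. The right-hand side is a sum, so that
  it can be added up over pairs.\<close>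

lemma card_flags_2_le:
  assumes X: "X \<in> subspaces_of V" "X \<noteq> {0}" and Y: "Y \<in> subspaces_of V" "Y \<noteq> V" and XY: "X \<subset> Y"
  shows "real (card {zs \<in> frames V {0} n. flag zs (dim X) = X \<and> flag zs (dim Y) = Y}) * real q ^ (n div 2 - 1)
    \<le> flags_through X + flags_through Y"
proof -
  note X' = subspaces_ofD[OF X(1)] and Y' = subspaces_ofD[OF Y(1)]
  define x y where "x = dim X" and "y = dim Y"
  have "x \<noteq> 0" using subspace_dim_equal_finite[OF subspace_single_0 X'(1,3,4)] X(2) by (auto simp: x_def dim_zero)
  have "x \<le> y" using dim_mono_finite X' Y' XY unfolding x_def y_def by blast
  moreover have "x \<noteq> y" using subspace_dim_equal_finite[OF X'(1) Y'(1,3)] XY unfolding x_def y_def by blast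
  moreover have "y \<noteq> n" using subspace_dim_equal_finite[OF Y'(1) V Y'(2)] Y(2) n unfolding y_def by blast
  ultimately have ord: "1 \<le> x" "x < y" "y < n" using \<open>x \<noteq> 0\<close> Y'(5) unfolding y_def by auto
  have pos: "frame_count w u m \<ge> 0" if "u + m \<le> w" for w u m
    using frame_count_pos[OF that] by simp
  let ?h = "n div 2 - 1"
  have c2: "real (card {zs \<in> frames V {0} n. flag zs (dim X) = X \<and> flag zs (dim Y) = Y})
    = frame_count x 0 x * (frame_count y x (y - x) * frame_count n y (n - y))" (is "?c2 = _")
    using card_flags_2[OF X(1) Y(1)] XY unfolding x_def y_def by simp
  have pX: "0 \<le> flags_through X" and pY: "0 \<le> flags_through Y" by (simp_all add: flags_through_def)
  have qpow: "real q ^ ?h \<le> real q ^ e" if "?h \<le> e" for e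
    using q_ge_2 that by (intro power_increasing) auto
  show ?thesis
  proof (cases "n div 2 \<le> y")
    case True
    \<comment> \<open>A product of two positive integers is at least their sum minus one; here the
      sum is y.\<close>
    have "(y - 1) \<le> (y - x) * x"
    proof -
      obtain a b where "x = Suc a" "y - x = Suc b" using ord by (metis Suc_le_D One_nat_def Suc_diff_Suc)
      then show ?thesis using ord by (auto simp: algebra_simps)
    qed
    then have "frame_count x 0 x * real q ^ ?h \<le> frame_count x 0 x * real q ^ ((y - x) * x)"
      using True pos by (intro mult_left_mono qpow) auto
    also have "\<dots> \<le> frame_count y 0 x" using ord by (intro frame_count_mono) auto
    finally have "frame_count x 0 x * real q ^ ?h * (frame_count y x (y - x) * frame_count n y (n - y))
       \<le> frame_count y 0 x * (frame_count y x (y - x) * frame_count n y (n - y))"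
      using ord pos by (intro mult_right_mono mult_nonneg_nonneg) auto
    also have "\<dots> = frame_count y 0 y * frame_count n y (n - y)"
      using frame_count_add[of y 0 x "y - x"] ord by simp
    also have "\<dots> = flags_through Y"
      using card_flags_1[OF Y(1)] by (simp add: flags_through_def y_def)
    finally show ?thesis unfolding c2 using pX by (simp add: mult_ac)
  next
    case False
    \<comment> \<open>The same inequality for two factors with sum n - x, where now x < y < n div
      2.\<close>
    have "(n - x - 1) \<le> (n - y) * (y - x)"
    proof -
      obtain a b where "n - y = Suc a" "y - x = Suc b" using ord by (metis Suc_diff_Suc)
      moreover from this have "n - x = Suc (Suc (a + b))" using ord by linarith
      ultimately show ?thesis by (simp add: algebra_simps)
    qed
    then have "frame_count y x (y - x) * real q ^ ?h \<le> frame_count y x (y - x) * real q ^ ((n - y) * (y - x))"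
      using False ord pos by (intro mult_left_mono qpow) auto
    also have "\<dots> \<le> frame_count n x (y - x)" using ord by (intro frame_count_mono) auto
    finally have "frame_count y x (y - x) * real q ^ ?h * (frame_count x 0 x * frame_count n y (n - y))
       \<le> frame_count n x (y - x) * (frame_count x 0 x * frame_count n y (n - y))"
      using ord pos by (intro mult_right_mono mult_nonneg_nonneg) auto
    also have "\<dots> = frame_count x 0 x * frame_count n x (n - x)"
      using frame_count_add[of n x "y - x" "n - y"] ord by simp
    also have "\<dots> = flags_through X"
      using card_flags_1[OF X(1)] by (simp add: flags_through_def x_def)
    finally show ?thesis unfolding c2 using pY by (simp add: mult_ac)
  qed
qed

end

end

section \<open>Supersaturation and Gaussian binomial coefficients\<close>

lemma sum_card_swap:
  assumes "finite A" "finite B"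
  shows "(\<Sum>a\<in>A. card {b\<in>B. P a b}) = (\<Sum>b\<in>B. card {a\<in>A. P a b})"
  unfolding card_eq_sum by (rule sum.swap_restrict[OF assms])

context finite_field_space
begin

text \<open>The members of U on a fixed flag form a chain, so \<open>card_chain_le\<close> applies;
  summing over all ordered bases and exchanging the sums gives the claim.\<close>

lemma flag_double_count:
  assumes V: "subspace V" "finite V" and n: "n = dim V" and U: "U \<subseteq> subspaces_of V"
  shows "(\<Sum>X\<in>U. real (card {zs \<in> frames V {0} n. flag zs (dim X) = X}))
    \<le> frame_count n 0 n + (\<Sum>(X, Y)\<in>{(X, Y). X \<in> U \<and> Y \<in> U \<and> X \<subset> Y}.
        real (card {zs \<in> frames V {0} n. flag zs (dim X) = X \<and> flag zs (dim Y) = Y}))"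
proof -
  let ?F = "frames V {0} n"
  let ?E = "{(X, Y). X \<in> U \<and> Y \<in> U \<and> X \<subset> Y}"
  let ?C = "\<lambda>zs. {X\<in>U. flag zs (dim X) = X}"
  have fU: "finite U" using U finite_subspaces_of[OF V(2)] finite_subset by blast
  have fE: "finite ?E" by (rule finite_subset[of _ "U \<times> U"]) (use fU in auto)
  have fF: "finite ?F" by (rule finite_frames[OF V(2)])
  have chain: "card (?C zs) \<le> 1 + card {p\<in>?E. flag zs (dim (fst p)) = fst p \<and> flag zs (dim (snd p)) = snd p}" for zs
  proof -
    have "card (?C zs) \<le> 1 + card {(X, Y). X \<in> ?C zs \<and> Y \<in> ?C zs \<and> X \<subset> Y}"
    proof (rule card_chain_le)
      fix X Y assume "X \<in> ?C zs" "Y \<in> ?C zs"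
      then have "flag zs (dim X) = X" "flag zs (dim Y) = Y" by auto
      then show "X \<subseteq> Y \<or> Y \<subseteq> X"
        using flag_mono[of "dim X" "dim Y" zs] flag_mono[of "dim Y" "dim X" zs] by (metis nat_le_linear)
    qed (use fU in simp)
    also have "{(X, Y). X \<in> ?C zs \<and> Y \<in> ?C zs \<and> X \<subset> Y}
        = {p\<in>?E. flag zs (dim (fst p)) = fst p \<and> flag zs (dim (snd p)) = snd p}"
      by fastforce
    finally show ?thesis .
  qed
  have "(\<Sum>X\<in>U. card {zs \<in> ?F. flag zs (dim X) = X}) = (\<Sum>zs\<in>?F. card (?C zs))"
    by (rule sum_card_swap[OF fU fF])
  also have "\<dots> \<le> (\<Sum>zs\<in>?F. 1 + card {p\<in>?E. flag zs (dim (fst p)) = fst p \<and> flag zs (dim (snd p)) = snd p})"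
    by (intro sum_mono chain)
  also have "\<dots> = card ?F + (\<Sum>zs\<in>?F. card {p\<in>?E. flag zs (dim (fst p)) = fst p \<and> flag zs (dim (snd p)) = snd p})"
    by (simp only: sum.distrib) simp
  also have "\<dots> = card ?F + (\<Sum>p\<in>?E. card {zs\<in>?F. flag zs (dim (fst p)) = fst p \<and> flag zs (dim (snd p)) = snd p})"
    by (simp only: sum_card_swap[OF fF fE])
  finally have "real (\<Sum>X\<in>U. card {zs \<in> ?F. flag zs (dim X) = X})
     \<le> real (card ?F + (\<Sum>p\<in>?E. card {zs\<in>?F. flag zs (dim (fst p)) = fst p \<and> flag zs (dim (snd p)) = snd p}))"
    by (rule of_nat_mono)
  moreover have "real (card ?F) = frame_count n 0 n"
    using card_frames[OF V subspace_single_0, of n] V n by (simp add: dim_zero subspace_0)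
  ultimately show ?thesis by (simp add: case_prod_beta')
qed

text \<open>A weighted handshake count: Z contributes \<open>f Z\<close> once for every comparable
  pair in which it is the lower or the upper member.\<close>

lemma sum_comparable_pairs:
  fixes f :: "'x set \<Rightarrow> real"
  assumes "finite U"
  shows "(\<Sum>(X, Y)\<in>{(X, Y). X \<in> U \<and> Y \<in> U \<and> X \<subset> Y}. f X + f Y)
     = (\<Sum>Z\<in>U. f Z * card {W\<in>U. W \<noteq> Z \<and> (W \<subseteq> Z \<or> Z \<subseteq> W)})"
proof -
  have fS: "finite {W\<in>U. Q W}" for Q using assms by simp
  have E1: "{(X, Y). X \<in> U \<and> Y \<in> U \<and> X \<subset> Y} = (SIGMA X:U. {Y\<in>U. X \<subset> Y})" by auto
  have E2: "{(X, Y). X \<in> U \<and> Y \<in> U \<and> X \<subset> Y} = prod.swap ` (SIGMA Y:U. {X\<in>U. X \<subset> Y})"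
    by (auto simp: image_iff)
  have "(\<Sum>(X, Y)\<in>{(X, Y). X \<in> U \<and> Y \<in> U \<and> X \<subset> Y}. f X) = (\<Sum>X\<in>U. \<Sum>Y\<in>{Y\<in>U. X \<subset> Y}. f X)"
    unfolding E1 by (rule sum.Sigma[symmetric]) (use assms in auto)
  moreover have "(\<Sum>(X, Y)\<in>{(X, Y). X \<in> U \<and> Y \<in> U \<and> X \<subset> Y}. f Y) = (\<Sum>Y\<in>U. \<Sum>X\<in>{X\<in>U. X \<subset> Y}. f Y)"
  proof -
    have "(\<Sum>(X, Y)\<in>{(X, Y). X \<in> U \<and> Y \<in> U \<and> X \<subset> Y}. f Y) = (\<Sum>(Y, X)\<in>(SIGMA Y:U. {X\<in>U. X \<subset> Y}). f Y)"
      unfolding E2 by (subst sum.reindex) (auto simp: case_prod_beta')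
    also have "\<dots> = (\<Sum>Y\<in>U. \<Sum>X\<in>{X\<in>U. X \<subset> Y}. f Y)"
      by (rule sum.Sigma[symmetric]) (use assms in auto)
    finally show ?thesis .
  qed
  moreover have "card {W\<in>U. W \<noteq> Z \<and> (W \<subseteq> Z \<or> Z \<subseteq> W)} = card {Y\<in>U. Z \<subset> Y} + card {X\<in>U. X \<subset> Z}" for Z
    by (subst card_Un_disjoint[symmetric]) (use assms in \<open>auto intro!: arg_cong[where f=card]\<close>)
  ultimately show ?thesis
    by (simp add: case_prod_beta' sum.distrib distrib_left mult.commute)
qed

text \<open>The supersaturated LYM inequality in contrapositive form. Bounded degrees make the pair
  term in \<open>flag_double_count\<close> at most s / q^(n div 2 - 1) times the left-hand side,
  while each X in U accounts for at least a fraction 1 / N of all flags.\<close>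

lemma card_sparse_le:
  assumes V: "subspace V" "finite V" and n: "n = dim V"
    and U: "U \<subseteq> subspaces_of V - {{0}, V}"
    and N: "\<And>k. k \<le> n \<Longrightarrow> real (gbinom V k) \<le> N"
    and sparse: "\<And>Z. Z \<in> U \<Longrightarrow> real (card {W\<in>U. W \<noteq> Z \<and> (W \<subseteq> Z \<or> Z \<subseteq> W)}) \<le> s"
    and s: "s \<le> real q ^ (n div 2 - 1)"
  shows "real (card U) * (1 - s / real q ^ (n div 2 - 1)) \<le> N"
proof -
  let ?E = "{(X, Y). X \<in> U \<and> Y \<in> U \<and> X \<subset> Y}"
  define Q where "Q = real q ^ (n div 2 - 1)"
  define c where "c = flags_through V n"
  define B where "B = frame_count n 0 n"
  have Qpos: "Q > 0" using q_ge_2 by (simp add: Q_def)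
  have B: "B > 0" unfolding B_def by (rule frame_count_pos) simp
  have U': "U \<subseteq> subspaces_of V" using U by blast
  have fU: "finite U" using U' finite_subspaces_of[OF V(2)] finite_subset by blast
  have cpos: "c X \<ge> 0" for X by (simp add: c_def flags_through_def[OF V n])
  have "(\<Sum>X\<in>U. c X) \<le> B + (\<Sum>(X, Y)\<in>?E.
      real (card {zs \<in> frames V {0} n. flag zs (dim X) = X \<and> flag zs (dim Y) = Y}))"
    using flag_double_count[OF V n U'] by (simp add: c_def B_def flags_through_def[OF V n])
  also have "\<dots> \<le> B + (\<Sum>(X, Y)\<in>?E. (c X + c Y) / Q)"
  proof (intro add_left_mono sum_mono)
    fix p assume "p \<in> ?E"
    then obtain X Y where p: "p = (X, Y)" "X \<in> U" "Y \<in> U" "X \<subset> Y" by blast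
    have "real (card {zs \<in> frames V {0} n. flag zs (dim X) = X \<and> flag zs (dim Y) = Y}) * Q \<le> c X + c Y"
      using card_flags_2_le[OF V n, of X Y] U p unfolding c_def Q_def by blast
    then show "(case p of (X, Y) \<Rightarrow> real (card {zs \<in> frames V {0} n. flag zs (dim X) = X \<and> flag zs (dim Y) = Y}))
        \<le> (case p of (X, Y) \<Rightarrow> (c X + c Y) / Q)"
      using Qpos by (simp add: p pos_le_divide_eq)
  qed
  also have "(\<Sum>(X, Y)\<in>?E. (c X + c Y) / Q) = (\<Sum>(X, Y)\<in>?E. c X + c Y) / Q"
    by (simp add: case_prod_beta' sum_divide_distrib)
  also have "(\<Sum>(X, Y)\<in>?E. c X + c Y) = (\<Sum>Z\<in>U. c Z * card {W\<in>U. W \<noteq> Z \<and> (W \<subseteq> Z \<or> Z \<subseteq> W)})"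
    by (rule sum_comparable_pairs[OF fU])
  also have "\<dots> \<le> (\<Sum>Z\<in>U. c Z * s)"
    by (intro sum_mono mult_left_mono sparse cpos)
  also have "\<dots> = (\<Sum>Z\<in>U. c Z) * s" by (simp add: sum_distrib_right)
  \<comment> \<open>The pair term is a multiple of the left-hand sum and is moved to that
    side.\<close>
  finally have main: "(\<Sum>X\<in>U. c X) * (1 - s / Q) \<le> B"
    using Qpos by (simp add: divide_right_mono field_simps)
  have cB: "B \<le> N * c X" if "X \<in> U" for X
  proof -
    have X: "X \<in> subspaces_of V" using that U' by blast
    have "B = real (gbinom V (dim X)) * c X"
      using flags_through_gbinom[OF V n X] by (simp add: B_def c_def)
    also have "\<dots> \<le> N * c X"
      using N subspaces_ofD(5)[OF V n X] cpos by (intro mult_right_mono) auto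
    finally show ?thesis .
  qed
  \<comment> \<open>The sign is what permits replacing each \<open>c X\<close> by its lower bound B
    / N below.\<close>
  have sQ: "0 \<le> 1 - s / Q" using s Qpos by (simp add: Q_def)
  have N0: "0 \<le> N" using N[of 0] by (meson le0 of_nat_0_le_iff order_trans)
  have "B * (real (card U) * (1 - s / Q)) = (\<Sum>X\<in>U. B) * (1 - s / Q)" by simp
  also have "\<dots> \<le> (\<Sum>X\<in>U. N * c X) * (1 - s / Q)"
    by (intro mult_right_mono sum_mono cB sQ)
  also have "\<dots> = N * ((\<Sum>X\<in>U. c X) * (1 - s / Q))" by (simp add: sum_distrib_left mult.assoc)
  also have "\<dots> \<le> N * B" by (rule mult_left_mono[OF main N0])
  finally have "B * (real (card U) * (1 - s / Q)) \<le> B * N" by (simp only: mult.commute)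
  then show ?thesis using B unfolding Q_def by (simp only: mult_le_cancel_left_pos)
qed

section \<open>Growth and decay of Gaussian binomial coefficients\<close>

text \<open>The ratio of consecutive coefficients, cross-multiplied; it follows by comparing
  \<open>gbinom_frame_count\<close> at k and at k + 1.\<close>

lemma gbinom_Suc:
  assumes V: "subspace V" "finite V" and n: "n = dim V" and "k < n"
  shows "(real q ^ Suc k - 1) * gbinom V (Suc k) = (real q ^ (n - k) - 1) * gbinom V k"
proof -
  \<comment> \<open>After the first factor is split off, each remaining q^(k+1) - q^(i+1) is q times
    a factor of \<open>frame_count k 0 k\<close>.\<close>
  have e1: "frame_count (Suc k) 0 (Suc k) = (real q ^ Suc k - 1) * (real q ^ k * frame_count k 0 k)"
  proof -
    have "frame_count (Suc k) 0 (Suc k) = (real q ^ Suc k - 1) * (\<Prod>i<k. real q * (real q ^ k - real q ^ i))"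
      unfolding frame_count_def by (subst prod.lessThan_Suc_shift) (simp add: algebra_simps)
    then show ?thesis by (simp add: frame_count_def prod.distrib)
  qed
  have e2: "frame_count n 0 (Suc k) = frame_count n 0 k * (real q ^ k * (real q ^ (n - k) - 1))"
    using assms by (simp add: frame_count_def algebra_simps flip: power_add)
  have "real (gbinom V (Suc k)) * frame_count (Suc k) 0 (Suc k) = frame_count n 0 (Suc k)"
    using gbinom_frame_count[OF V n] assms by simp
  also have "\<dots> = gbinom V k * frame_count k 0 k * (real q ^ k * (real q ^ (n - k) - 1))"
    unfolding e2 using gbinom_frame_count[OF V n, of k] assms by simp
  finally have "(real q ^ k * frame_count k 0 k) * ((real q ^ Suc k - 1) * gbinom V (Suc k))
     = (real q ^ k * frame_count k 0 k) * ((real q ^ (n - k) - 1) * gbinom V k)"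
    unfolding e1 by (simp only: mult_ac)
  moreover have "real q ^ k * frame_count k 0 k > 0"
    using q_ge_2 frame_count_pos[of 0 k k] by simp
  ultimately show ?thesis by (simp only: mult_left_cancel[OF less_imp_neq[THEN not_sym]])
qed

text \<open>Below the middle n - k \<ge> k + 2, so the ratio (q^(n-k) - 1) / (q^(k+1) - 1) is at
  least q.\<close>

lemma gbinom_double:
  assumes V: "subspace V" "finite V" and n: "n = dim V" and "Suc k \<le> n div 2"
  shows "2 * gbinom V k \<le> gbinom V (Suc k)"
proof -
  have q2: "real q \<ge> 2" using q_ge_2 by simp
  define c where "c = real q ^ Suc k - 1"
  have c: "c > 0" using q2 unfolding c_def by (simp add: one_less_power del: power_Suc)
  have "2 * c \<le> real q ^ Suc (Suc k) - 1"
  proof -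
    have "2 * real q ^ Suc k \<le> real q * real q ^ Suc k" using q2 by (intro mult_right_mono) auto
    then show ?thesis by (simp add: c_def)
  qed
  also have "real q ^ Suc (Suc k) \<le> real q ^ (n - k)"
    using q2 assms(4) by (intro power_increasing) auto
  finally have "2 * c \<le> real q ^ (n - k) - 1" by simp
  then have "2 * c * gbinom V k \<le> (real q ^ (n - k) - 1) * gbinom V k" by (intro mult_right_mono) auto
  also have "\<dots> = c * gbinom V (Suc k)"
    using gbinom_Suc[OF V n, of k] assms(4) by (simp add: c_def)
  finally have "c * (2 * gbinom V k) \<le> c * gbinom V (Suc k)" by (simp add: mult_ac)
  then have "real (2 * gbinom V k) \<le> real (gbinom V (Suc k))" using c by simp
  then show ?thesis by (simp only: of_nat_le_iff)
qed

text \<open>The ratio is at most 1 because n - k \<le> k + 1. For n = 2k + 1 it equals 1, so no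
  factor 2 can be gained here.\<close>

lemma gbinom_middle:
  assumes V: "subspace V" "finite V" and n: "n = dim V" and "n \<le> 2 * k + 1" "k < n"
  shows "gbinom V (Suc k) \<le> gbinom V k"
proof -
  have q2: "real q \<ge> 2" using q_ge_2 by simp
  define c where "c = real q ^ Suc k - 1"
  have c: "c > 0" using q2 unfolding c_def by (simp add: one_less_power del: power_Suc)
  have "c * gbinom V (Suc k) = (real q ^ (n - k) - 1) * gbinom V k"
    using gbinom_Suc[OF V n assms(5)] by (simp add: c_def)
  also have "\<dots> \<le> c * gbinom V k"
    unfolding c_def using q2 assms by (intro mult_right_mono diff_right_mono power_increasing) auto
  finally have "real (gbinom V (Suc k)) \<le> real (gbinom V k)" using c by simp
  then show ?thesis by (simp only: of_nat_le_iff)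
qed

lemma gbinom_halve:
  assumes V: "subspace V" "finite V" and n: "n = dim V" and "n \<le> 2 * k" "k < n"
  shows "2 * gbinom V (Suc k) \<le> gbinom V k"
proof -
  have q2: "real q \<ge> 2" using q_ge_2 by simp
  define c where "c = real q ^ (n - k) - 1"
  have c: "c > 0" using q2 assms(5) unfolding c_def by (simp add: one_less_power)
  have "2 * c \<le> real q * real q ^ (n - k) - 1"
  proof -
    have "2 * real q ^ (n - k) \<le> real q * real q ^ (n - k)" using q2 by (intro mult_right_mono) auto
    then show ?thesis by (simp add: c_def)
  qed
  also have "real q * real q ^ (n - k) \<le> real q ^ Suc k"
    unfolding power_Suc[symmetric] using q2 assms by (intro power_increasing) auto
  finally have "2 * c * gbinom V (Suc k) \<le> (real q ^ Suc k - 1) * gbinom V (Suc k)"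
    by (intro mult_right_mono) auto
  also have "\<dots> = c * gbinom V k"
    using gbinom_Suc[OF V n assms(5)] by (simp add: c_def)
  finally have "c * (2 * gbinom V (Suc k)) \<le> c * gbinom V k" by (simp add: mult_ac)
  then have "real (2 * gbinom V (Suc k)) \<le> real (gbinom V k)" using c by simp
  then show ?thesis by (simp only: of_nat_le_iff)
qed

lemma gbinom_le_middle:
  assumes V: "subspace V" "finite V" and n: "n = dim V" and "k \<le> n"
  shows "gbinom V k \<le> gbinom V (n div 2)"
proof (cases "k \<le> n div 2")
  case True
  then show ?thesis
  proof (induction k rule: inc_induct)
    case (step k)
    then show ?case using gbinom_double[OF V n, of k] by linarith
  qed simp
next
  case False
  then have "n div 2 \<le> k" by simp
  then show ?thesis using \<open>k \<le> n\<close>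
  proof (induction k rule: dec_induct)
    case (step k)
    have "gbinom V (Suc k) \<le> gbinom V k"
      using step.hyps step.prems by (intro gbinom_middle[OF V n]) auto
    then show ?case using step by linarith
  qed simp
qed

text \<open>Layers decay geometrically on both sides: those up to the middle add up to at most twice
  the middle one, those above it to at most twice the next one. The upper sum starts at
  \<open>Suc m\<close> since for odd n the layers m and m + 1 have equal size.\<close>

lemma card_subspaces_of_le:
  assumes V: "subspace V" "finite V" and n: "n = dim V" and "n \<ge> 1"
  shows "card (subspaces_of V) \<le> 4 * gbinom V (n div 2)"
proof -
  define m where "m = n div 2"
  have m: "m < n" using assms(4) by (simp add: m_def)
  have lower: "(\<Sum>k\<le>j. gbinom V k) \<le> 2 * gbinom V j" if "j \<le> m" for j
    using that
  proof (induction j)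
    case (Suc j)
    then show ?case using gbinom_double[OF V n, of j] by (simp add: m_def)
  qed simp
  \<comment> \<open>Twice the next layer is carried along as a bound for the remaining tail. At the
    last j the index is n + 1, where the \<open>if\<close> supplies 0.\<close>
  have upper: "(\<Sum>k=Suc m..<Suc m + j. gbinom V k) + 2 * (if Suc m + j \<le> n then gbinom V (Suc m + j) else 0)
     \<le> 2 * gbinom V (Suc m)" if "Suc m + j \<le> Suc n" for j
    using that
  proof (induction j)
    case (Suc j)
    have "2 * (if Suc m + Suc j \<le> n then gbinom V (Suc m + Suc j) else 0) \<le> gbinom V (Suc m + j)"
      using gbinom_halve[OF V n, of "Suc m + j"] Suc.prems by (auto simp: m_def)
    then show ?case using Suc by simp
  qed (use m in simp)
  have "(\<Sum>k=Suc m..<Suc n. gbinom V k) \<le> 2 * gbinom V (Suc m)"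
    using upper[of "n - m"] m by simp
  also have "\<dots> \<le> 2 * gbinom V m" using gbinom_le_middle[OF V n, of "Suc m"] m by (simp add: m_def)
  finally have up: "(\<Sum>k=Suc m..<Suc n. gbinom V k) \<le> 2 * gbinom V m" .
  have fin: "finite (subspaces_of V)" by (rule finite_subspaces_of[OF V(2)])
  have "card (subspaces_of V) = card (\<Union>k\<le>n. {W \<in> subspaces_of V. dim W = k})"
    using subspaces_ofD(5)[OF V n] by (intro arg_cong[where f=card]) auto
  also have "\<dots> = (\<Sum>k\<le>n. gbinom V k)"
    unfolding gbinom_def using fin by (intro card_UN_disjoint) auto
  also have "\<dots> = (\<Sum>k\<le>m. gbinom V k) + (\<Sum>k=Suc m..<Suc n. gbinom V k)"
    using m by (subst sum.union_disjoint[symmetric]) (auto intro!: sum.cong)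
  also have "\<dots> \<le> 4 * gbinom V m" using lower[of m] up by simp
  finally show ?thesis by (simp add: m_def)
qed

text \<open>A crude bound, sufficient to absorb an additive constant in the exponent.\<close>

lemma gbinom_middle_ge:
  assumes V: "subspace V" "finite V" and n: "n = dim V" and "n \<ge> 2"
  shows "real q ^ (n div 2) \<le> gbinom V (n div 2)"
proof -
  let ?m = "n div 2"
  have "frame_count ?m 0 ?m * real q ^ ?m \<le> frame_count ?m 0 ?m * real q ^ ((n - ?m) * ?m)"
    using q_ge_2 frame_count_pos[of 0 ?m ?m] assms(4) by (intro mult_left_mono power_increasing) auto
  also have "\<dots> \<le> frame_count n 0 ?m" by (intro frame_count_mono) auto
  also have "\<dots> = frame_count ?m 0 ?m * gbinom V ?m"
    using gbinom_frame_count[OF V n, of ?m] by (simp add: mult.commute)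
  finally show ?thesis using frame_count_pos[of 0 ?m ?m] by simp
qed

end

section \<open>Antichains of subspaces\<close>

interpretation vs: finite_field_space "fscale :: 'a::{field, finite} \<Rightarrow> (nat \<Rightarrow> 'a) \<Rightarrow> nat \<Rightarrow> 'a" "CARD('a)"
  by unfold_locales (auto simp: fscale_def fun_eq_iff algebra_simps)

lemma subspace_Fqn: "vs.subspace (Fqn n :: (nat \<Rightarrow> 'a::{field, finite}) set)"
  unfolding vs.subspace_def by (auto simp: Fqn_def fscale_def)

lemma card_Fqn: "card (Fqn n :: (nat \<Rightarrow> 'a::{field, finite}) set) = CARD('a) ^ n"
proof -
  \<comment> \<open>Extends a function on \<open>{..<n}\<close> by 0 in place of the value
    \<open>undefined\<close> of extensional functions.\<close>
  let ?f = "\<lambda>(g :: nat \<Rightarrow> 'a) i. if i < n then g i else 0"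
  have "card (?f ` ({..<n} \<rightarrow>\<^sub>E UNIV)) = card ({..<n} \<rightarrow>\<^sub>E (UNIV :: 'a set))"
    by (rule card_image, rule inj_onI, rule PiE_ext, assumption, assumption) (metis lessThan_iff)
  moreover have "?f ` ({..<n} \<rightarrow>\<^sub>E UNIV) = Fqn n"
  proof (intro equalityI subsetI)
    fix v :: "nat \<Rightarrow> 'a" assume "v \<in> Fqn n"
    then have "v = ?f (restrict v {..<n})" by (auto simp: Fqn_def fun_eq_iff)
    then show "v \<in> ?f ` ({..<n} \<rightarrow>\<^sub>E UNIV)" by (rule image_eqI[where f = ?f]) (auto split: if_splits)
  next
    fix v assume "v \<in> ?f ` ({..<n} \<rightarrow>\<^sub>E UNIV)"
    then obtain w where "v = ?f w" by blast
    then show "v \<in> Fqn n" by (simp add: Fqn_def)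
  qed
  ultimately have "card (Fqn n :: (nat \<Rightarrow> 'a) set) = card ({..<n} \<rightarrow>\<^sub>E (UNIV :: 'a set))"
    by (simp only:)
  also have "\<dots> = CARD('a) ^ n" by (subst card_PiE) simp_all
  finally show ?thesis .
qed

lemma finite_Fqn: "finite (Fqn n :: (nat \<Rightarrow> 'a::{field, finite}) set)"
  by (rule card_ge_0_finite) (simp add: card_Fqn)

lemma dim_Fqn: "vs.dim (Fqn n :: (nat \<Rightarrow> 'a::{field, finite}) set) = n"
proof -
  have "CARD('a) ^ vs.dim (Fqn n :: (nat \<Rightarrow> 'a) set) = CARD('a) ^ n"
    using vs.card_subspace[OF subspace_Fqn finite_Fqn] card_Fqn by metis
  then show ?thesis using vs.q_ge_2[where 'a='a] by simp
qed

lemma subspaces_eq: "subspaces n = vs.subspaces_of (Fqn n :: (nat \<Rightarrow> 'a::{field, finite}) set)"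
  by (auto simp: subspaces_def vs.subspaces_of_def)

lemma gauss_binom_eq:
  "gauss_binom TYPE('a::{field, finite}) n k = vs.gbinom (Fqn n :: (nat \<Rightarrow> 'a) set) k"
  unfolding gauss_binom_def vs.gbinom_def subspaces_eq ..

lemma finite_subspaces: "finite (subspaces n :: (nat \<Rightarrow> 'a::{field, finite}) set set)"
  unfolding subspaces_eq by (rule vs.finite_subspaces_of[OF finite_Fqn])

lemma finite_antichains: "finite {A :: (nat \<Rightarrow> 'a::{field, finite}) set set. is_antichain n A}"
  by (rule finite_subset[of _ "Pow (subspaces n)"]) (auto simp: is_antichain_def finite_subspaces)

section \<open>Lower and upper bounds for the number of antichains\<close>

text \<open>Nested subspaces of equal dimension coincide, so every set of k-dimensional subspaces is
  an antichain.\<close>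

lemma num_antichains_ge:
  "2 ^ gauss_binom TYPE('a::{field, finite}) n k \<le> num_antichains TYPE('a) n"
proof -
  let ?L = "{W \<in> subspaces n :: (nat \<Rightarrow> 'a) set set. vs.dim W = k}"
  have "Pow ?L \<subseteq> {A. is_antichain n A}"
  proof
    fix A assume A: "A \<in> Pow ?L"
    have "X = Y" if "X \<in> A" "Y \<in> A" "X \<subseteq> Y" for X Y
    proof (rule vs.subspace_dim_equal_finite)
      have "X \<in> ?L" "Y \<in> ?L" using that A by auto
      then show "vs.subspace X" "vs.subspace Y" "vs.dim X = vs.dim Y" "finite Y"
        using finite_subset[OF _ finite_Fqn] by (auto simp: subspaces_def)
    qed fact
    then show "A \<in> {A. is_antichain n A}" using A by (auto simp: is_antichain_def)
  qed
  then have "card (Pow ?L) \<le> num_antichains TYPE('a) n"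
    unfolding num_antichains_def by (rule card_mono[OF finite_antichains])
  then show ?thesis
    using finite_subspaces[of n, where 'a='a] by (simp add: gauss_binom_def card_Pow)
qed

lemma num_antichains_le:
  fixes n :: nat and s :: real
  defines "N \<equiv> real (gauss_binom TYPE('a::{field, finite}) n (n div 2))"
    and "Q \<equiv> real CARD('a) ^ (n div 2 - 1)"
  assumes s: "exp 1 \<le> s" "s < Q" and n: "n \<ge> 1"
  shows "real (num_antichains TYPE('a) n)
    \<le> 2 powr (N / (1 - s / Q) + 2) * exp (ln s / s * (4 * N))"
proof -
  let ?V = "Fqn n :: (nat \<Rightarrow> 'a) set"
  let ?S = "subspaces n :: (nat \<Rightarrow> 'a) set set"
  \<comment> \<open>The 2 pays for {0} and the whole space, which lie on every flag and are removed
    before \<open>card_sparse_le\<close> is applied.\<close>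
  let ?K = "N / (1 - s / Q) + 2"
  note V = subspace_Fqn[of n, where 'a='a] finite_Fqn[of n, where 'a='a] dim_Fqn[of n, where 'a='a, symmetric]
  have s0: "s \<ge> 1" using s(1) exp_ge_add_one_self[of 1] by linarith
  have dense: "\<exists>v\<in>U. s \<le> card {u\<in>U. u \<noteq> v \<and> (u \<subseteq> v \<or> v \<subseteq> u)}" if U: "U \<subseteq> ?S" "real (card U) > ?K" for U
  proof (rule ccontr)
    assume "\<not> ?thesis"
    then have sp: "real (card {u\<in>U. u \<noteq> v \<and> (u \<subseteq> v \<or> v \<subseteq> u)}) \<le> s" if "v \<in> U" for v
      using that by (auto simp: not_le intro: less_imp_le)
    have fU: "finite U" using U(1) finite_subspaces finite_subset by blast
    define U' where "U' = U - {{0}, ?V}"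
    have "real (card U') * (1 - s / Q) \<le> N"
      unfolding Q_def
    proof (rule vs.card_sparse_le[OF V])
      show "U' \<subseteq> vs.subspaces_of ?V - {{0}, ?V}" using U(1) unfolding U'_def subspaces_eq by blast
      show "real (vs.gbinom ?V k) \<le> N" if "k \<le> n" for k
        using vs.gbinom_le_middle[OF V that] by (simp add: N_def gauss_binom_eq)
      show "s \<le> real CARD('a) ^ (n div 2 - 1)" using s by (simp add: Q_def)
      fix Z assume Z: "Z \<in> U'"
      have "card {W\<in>U'. W \<noteq> Z \<and> (W \<subseteq> Z \<or> Z \<subseteq> W)} \<le> card {u\<in>U. u \<noteq> Z \<and> (u \<subseteq> Z \<or> Z \<subseteq> u)}"
        by (rule card_mono) (use fU in \<open>auto simp: U'_def\<close>)
      then show "real (card {W\<in>U'. W \<noteq> Z \<and> (W \<subseteq> Z \<or> Z \<subseteq> W)}) \<le> s"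
        using sp[of Z] Z unfolding U'_def by fastforce
    qed
    moreover have "1 - s / Q > 0" using s s0 by simp
    ultimately have "real (card U') \<le> N / (1 - s / Q)" by (simp add: pos_le_divide_eq)
    moreover have "card U \<le> card U' + 2"
    proof -
      have "card U \<le> card (U' \<union> {{0}, ?V})"
        using fU by (intro card_mono) (auto simp: U'_def)
      also have "\<dots> \<le> card U' + card {{0}, ?V}" by (rule card_Un_le)
      also have "card {{0}, ?V} \<le> 2" by (simp add: card_insert_if)
      finally show ?thesis by simp
    qed
    ultimately show False using U(2) by linarith
  qed
  have "num_antichains TYPE('a) n = card {A. A \<subseteq> ?S \<and> (\<forall>x\<in>A. \<forall>y\<in>A. x \<subseteq> y \<longrightarrow> x = y)}"
    by (simp add: num_antichains_def is_antichain_def)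
  then have "real (num_antichains TYPE('a) n) \<le> 2 powr ?K * exp (ln s / s * card ?S)"
    using card_independent_sets_le[OF finite_subspaces s(1) dense] by simp
  also have "\<dots> \<le> 2 powr ?K * exp (ln s / s * (4 * N))"
  proof -
    have "card ?S \<le> 4 * gauss_binom TYPE('a) n (n div 2)"
      using vs.card_subspaces_of_le[OF V n] by (simp add: subspaces_eq gauss_binom_eq)
    then have "real (card ?S) \<le> 4 * N" unfolding N_def by linarith
    then show ?thesis using s0 by (intro mult_left_mono) (auto intro!: mult_left_mono divide_right_mono)
  qed
  finally show ?thesis .
qed


section \<open>Choice of the degree threshold and asymptotics\<close>

lemma num_antichains_itself: "num_antichains (F::'a::field itself) = num_antichains TYPE('a::field)"
  by (rule ext) (simp only: num_antichains_def)
lemma gauss_binom_itself: "gauss_binom (F::'a::field itself) = gauss_binom TYPE('a::field)"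
  by (intro ext) (simp only: gauss_binom_def)

text \<open>The O-term of the exponent is isolated by taking the binary logarithm, dividing by the
  middle Gaussian binomial and subtracting 1.\<close>

theorem mainTheorem3:
  fixes F :: "'a::{field, finite} itself"
  defines "q \<equiv> real CARD('a)"
  shows "(\<lambda>n. log 2 (real (num_antichains F n)) / real (gauss_binom F n (n div 2)) - 1)
           \<in> O(\<lambda>n. sqrt (real n) * q powr (- real n / 4))"
proof -
  have F: "num_antichains F = num_antichains TYPE('a)" "gauss_binom F = gauss_binom TYPE('a)"
    by (rule num_antichains_itself gauss_binom_itself)+
  have q2: "q \<ge> 2" using vs.q_ge_2[where 'a='a] by (simp add: q_def)
  define g where "g = (\<lambda>n::nat. sqrt (real n) * q powr (- real n / 4))"
  \<comment> \<open>The three summands come from 1 / (1 - s / Q), from the additive 2 divided by N,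
    and from the factor exp(4 N ln s / s).\<close>
  define C where "C = 2 * q powr (3/2) + 2 * q powr (1/2) + 4 / ln 2 * (1 / 2 + ln q / 4)"
  \<comment> \<open>The case q = 2, which dominates g for every q \<ge> 2.\<close>
  have "(\<lambda>n::nat. sqrt (real n) * exp (- real n / 4 * ln 2)) \<longlonglongrightarrow> 0" by real_asymp
  moreover have "g n \<le> sqrt (real n) * exp (- real n / 4 * ln 2)" for n
    using q2 by (auto simp: g_def powr_def intro!: mult_left_mono)
  ultimately have "g \<longlonglongrightarrow> 0"
    by (intro Lim_null_comparison[where f = g and g = "\<lambda>n. sqrt (real n) * exp (- real n / 4 * ln 2)"]
      always_eventually allI) (simp_all add: g_def)
  \<comment> \<open>This threshold forces s / Q < 1 / 2.\<close>
  then have "\<forall>\<^sub>F n in sequentially. g n < 1 / (2 * q powr (3/2))"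
    using q2 by (intro order_tendstoD) auto
  then have "\<forall>\<^sub>F n in sequentially. norm (log 2 (real (num_antichains F n)) / real (gauss_binom F n (n div 2)) - 1)
     \<le> C * norm (g n)"
    \<comment> \<open>For n \<ge> 9 one has sqrt n \<ge> 3 > e, hence s \<ge> e.\<close>
    using eventually_ge_at_top[of 9]
  proof eventually_elim
    case (elim n)
    define N where "N = real (gauss_binom F n (n div 2))"
    define Q where "Q = q ^ (n div 2 - 1)"
    define s where "s = sqrt (real n) * q powr (n / 4)"
    define M where "M = real (num_antichains F n)"
    have n9: "n \<ge> 9" and gsmall: "g n < 1 / (2 * q powr (3/2))" by fact+
    have sn: "sqrt (real n) \<ge> 3" using n9 by (intro real_le_rsqrt) simp
    have g0: "g n > 0" using n9 q2 by (simp add: g_def)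
    have s3: "s \<ge> 3"
      using sn mult_mono[OF sn ge_one_powr_ge_zero[of q "n/4"]] q2 by (simp add: s_def)
    have "s \<ge> exp 1" using s3 exp_le by linarith
    \<comment> \<open>Of the 3/2, 1/2 is lost by rounding n / 2 down and 1 by the exponent n div 2 -
      1.\<close>
    have "Q \<ge> q powr (n / 2 - 3 / 2)"
    proof -
      have "Q = q powr real (n div 2 - 1)" using q2 by (simp add: Q_def powr_realpow)
      moreover have "n / 2 - 3 / 2 \<le> real (n div 2 - 1)" using n9 by linarith
      ultimately show ?thesis using q2 by simp
    qed
    then have "s / Q \<le> s / q powr (n / 2 - 3 / 2)"
      using s3 q2 by (intro divide_left_mono) (auto simp: Q_def)
    also have "\<dots> = sqrt (real n) * (q powr (n / 4) / q powr (n / 2 - 3 / 2))" by (simp add: s_def)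
    also have "q powr (n / 4) / q powr (n / 2 - 3 / 2) = q powr (3/2) * q powr (- real n / 4)"
      by (simp flip: powr_diff powr_add)
    finally have t: "s / Q \<le> q powr (3/2) * g n" by (simp add: g_def mult_ac)
    also have "\<dots> < 1 / 2" using gsmall q2 by (simp add: field_simps)
    finally have t2: "s / Q < 1 / 2" .
    have Qpos: "Q > 0" using q2 by (simp add: Q_def)
    have "s < Q" using t2 Qpos s3 by (simp add: field_simps)
    \<comment> \<open>ln s is at most a constant multiple of n, and n = g n * s, so dividing by s
      leaves a constant multiple of g n.\<close>
    have lns: "ln s / s \<le> (1 / 2 + ln q / 4) * g n"
    proof -
      have "ln s = ln (real n) / 2 + n / 4 * ln q"
        using n9 q2 by (simp add: s_def ln_mult ln_sqrt ln_powr)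
      also have "\<dots> \<le> n / 2 + n / 4 * ln q"
        using n9 ln_le_minus_one[of "real n"] by simp
      also have "\<dots> = (1 / 2 + ln q / 4) * n" by (simp add: field_simps)
      also have "real n = g n * s"
        using q2 by (simp add: g_def s_def mult_ac flip: powr_add)
      finally show ?thesis using s3 by (simp add: pos_divide_le_eq mult.assoc)
    qed
    have Nge: "q powr (n / 2 - 1 / 2) \<le> N"
    proof -
      have "q powr (n / 2 - 1 / 2) \<le> q powr real (n div 2)"
        using q2 by (intro powr_mono) linarith+
      also have "\<dots> = q ^ (n div 2)" using q2 by (simp add: powr_realpow)
      also have "\<dots> \<le> N"
        using vs.gbinom_middle_ge[OF subspace_Fqn finite_Fqn dim_Fqn[where 'a='a, symmetric], of n] n9
        by (simp add: N_def F gauss_binom_eq q_def)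
      finally show ?thesis .
    qed
    have Npos: "N > 0" using Nge q2 by (smt (verit) powr_gt_zero)
    have "1 / N \<le> 1 / q powr (n / 2 - 1 / 2)"
      using Nge q2 Npos by (intro divide_left_mono) auto
    also have "\<dots> = q powr (1/2) * q powr (- real n / 2)"
      by (simp add: powr_minus_divide[symmetric] flip: powr_add)
    also have "\<dots> \<le> q powr (1/2) * g n"
    proof (intro mult_left_mono)
      have "1 * q powr (- real n / 2) \<le> sqrt (real n) * q powr (- real n / 4)"
        using n9 q2 by (intro mult_mono powr_mono) auto
      then show "q powr (- real n / 2) \<le> g n" by (simp add: g_def)
    qed simp
    finally have invN: "1 / N \<le> q powr (1/2) * g n" .
    have lowM: "2 powr N \<le> M"
    proof -
      have "real (2 ^ gauss_binom F n (n div 2)) \<le> M"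
        unfolding M_def F by (rule of_nat_mono[OF num_antichains_ge])
      then show ?thesis by (simp add: N_def powr_realpow)
    qed
    then have Mpos: "M > 0" by (smt (verit) powr_gt_zero)
    have low: "N \<le> log 2 M"
      using lowM Mpos by (simp add: le_log_iff)
    have "M \<le> 2 powr (N / (1 - s / Q) + 2) * exp (ln s / s * (4 * N))"
      unfolding M_def N_def Q_def F q_def
      by (rule num_antichains_le) (use \<open>s \<ge> exp 1\<close> \<open>s < Q\<close> n9 in \<open>simp_all add: Q_def q_def\<close>)
    then have "log 2 M \<le> log 2 (2 powr (N / (1 - s / Q) + 2) * exp (ln s / s * (4 * N)))"
      using Mpos by simp
    also have "\<dots> = N / (1 - s / Q) + 2 + (ln s / s * (4 * N)) / ln 2"
      by (simp add: log_mult)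
    finally have upper: "log 2 M \<le> \<dots>" .
    \<comment> \<open>For 0 \<le> t < 1/2 the product (1 + 2t)(1 - t) = 1 + t(1 - 2t) is at least
      1.\<close>
    have inv: "1 / (1 - s / Q) \<le> 1 + 2 * (s / Q)"
    proof -
      define t where "t = s / Q"
      have "0 \<le> t" "t < 1/2" using t2 s3 Qpos by (auto simp: t_def)
      then have "1 \<le> (1 + 2 * t) * (1 - t)"
        using mult_left_mono[of "2 * t" 1 t] by (simp add: algebra_simps)
      then show ?thesis using \<open>t < 1/2\<close> unfolding t_def[symmetric] by (simp add: pos_divide_le_eq)
    qed
    have "log 2 M / N \<le> (N / (1 - s / Q) + 2 + (ln s / s * (4 * N)) / ln 2) / N"
      using Npos by (intro divide_right_mono upper) simp
    also have "\<dots> = 1 / (1 - s / Q) + 2 * (1 / N) + 4 / ln 2 * (ln s / s)"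
      using Npos by (simp add: add_divide_distrib mult_ac)
    also have "\<dots> \<le> 1 + 2 * (q powr (3/2) * g n) + 2 * (q powr (1/2) * g n)
        + 4 / ln 2 * ((1 / 2 + ln q / 4) * g n)"
      using inv t by (intro add_mono mult_left_mono invN lns) auto
    also have "\<dots> = 1 + C * g n" by (simp add: C_def algebra_simps)
    finally have "log 2 M / N - 1 \<le> C * g n" by simp
    moreover have "0 \<le> log 2 M / N - 1" using low Npos by (simp add: pos_le_divide_eq)
    ultimately show ?case using g0 by (simp add: M_def N_def)
  qed
  then have "(\<lambda>n. log 2 (real (num_antichains F n)) / real (gauss_binom F n (n div 2)) - 1) \<in> O(g)"
    by (rule bigoI)
  then show ?thesis by (simp only: g_def)
qed

end
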